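(* Let $(m_n)_{n\ge1}$ be a sequence of complex numbers and let $(r_n)_{n\ge1}$ be its free cumulants. For each positive integer $d$ let $p_d$ be a monic polynomial of degree $d$, and suppose that $\lim_{d\to\infty} m_n(p_d)=m_n$ for every $n\in\mathbb N$. Then for every $n\in\mathbb N$, $\lim_{d\to\infty}\kappa^{(d)}_n=r_n$, where $\kappa^{(d)}_n$ is the $n$-th finite free cumulant of $p_d$ (defined for $d\ge n$); consequently $\lim_{d\to\infty}\kappa^{(d)}_\sigma=r_\sigma$ for every partition $\sigma$.
   Context: For a monic polynomial $p$ of degree $d$ write $p(x)=\sum_{i=0}^d (-1)^i a_i x^{d-i}$ ($a_0=1$), let $(d)_i=d(d-1)\cdots(d-i+1)$, and define the finite free cumulants $\kappa_1,\dots,\kappa_d$ of $p$ by $-\frac{1}{d}\frac{\partial}{\partial s}\ln\big(\sum_{i=0}^d \frac{(-d)^i a_i}{(d)_i}s^i\big)\equiv\sum_{j=0}^{d-1}\kappa_{j+1}s^j \pmod{s^d}$. If $p(x)=\prod_{i=1}^d(x-r_i)$, its moments are $m_n(p)=\frac1d\sum_i r_i^n$. A partition $\pi$ of $\{1,\dots,n\}$ is non-crossing if there are no $a<b<c<e$ with $a,c$ in one block and $b,e$ in a different block; $\mathcal{NC}(n)$ denotes the set of non-crossing partitions. The free cumulants $(r_n)$ of $(m_n)$ are the unique numbers with $m_n=\sum_{\pi\in\mathcal{NC}(n)}r_\pi$ for all $n$, where for any sequence $f_\pi=\prod_{V\in\pi}f_{|V|}$. *)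

theory Defs
  imports
    "HOL-Computational_Algebra.Computational_Algebra"
    "HOL-Library.Disjoint_Sets"
begin

definition noncrossing :: "nat set set \<Rightarrow> bool" where
  "noncrossing \<pi> \<longleftrightarrow>
     (\<nexists>a b c e V W. a < b \<and> b < c \<and> c < e \<and>
        V \<in> \<pi> \<and> W \<in> \<pi> \<and> V \<noteq> W \<and> a \<in> V \<and> c \<in> V \<and> b \<in> W \<and> e \<in> W)"

definition NC :: "nat \<Rightarrow> nat set set set" where
  "NC n = {\<pi>. partition_on {1..n} \<pi> \<and> noncrossing \<pi>}"

definition mult_ext :: "(nat \<Rightarrow> complex) \<Rightarrow> nat set set \<Rightarrow> complex" where
  "mult_ext f \<pi> = (\<Prod>V\<in>\<pi>. f (card V))"

(* Sequences indexed by the positive integers are functions on nat whose value at 0 is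
   irrelevant; blocks of a partition are nonempty, so mult_ext never uses that value. *)
definition free_cumulants_of :: "(nat \<Rightarrow> complex) \<Rightarrow> (nat \<Rightarrow> complex) \<Rightarrow> bool" where
  "free_cumulants_of m r \<longleftrightarrow> (\<forall>n\<ge>1. m n = (\<Sum>\<pi>\<in>NC n. mult_ext r \<pi>))"

(* Roots are counted with multiplicity. *)
definition poly_moment :: "complex poly \<Rightarrow> nat \<Rightarrow> complex" where
  "poly_moment p n = 1 / of_nat (degree p) * (\<Sum>x\<in>#proots p. x ^ n)"

(* The number a_i in p(x) = sum_{i <= d} (-1)^i a_i x^(d - i); only meant for i <= d. *)
definition signed_coeff :: "complex poly \<Rightarrow> nat \<Rightarrow> complex" where
  "signed_coeff p i = (-1) ^ i * coeff p (degree p - i)"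

definition falling :: "nat \<Rightarrow> nat \<Rightarrow> complex" where
  "falling d i = (\<Prod>k<i. of_nat d - of_nat k)"

definition cumulant_series :: "complex poly \<Rightarrow> complex fps" where
  "cumulant_series p = Abs_fps (\<lambda>i.
     if i \<le> degree p
     then (- of_nat (degree p)) ^ i * signed_coeff p i / falling (degree p) i
     else 0)"

(* fps_ln 1 is the series of ln (1 + X), so this is the formal logarithm of a series
   with constant term 1. *)
definition fps_log :: "complex fps \<Rightarrow> complex fps" where
  "fps_log F = fps_ln 1 oo (F - 1)"

(* kappa_n is the coefficient of s^(n - 1). It is only meant for monic p and
   1 <= n <= degree p: the defining congruence is modulo s^(degree p), and the later
   coefficients of the series are not cumulants. *)
definition finite_free_cumulant :: "complex poly \<Rightarrow> nat \<Rightarrow> complex" where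
  "finite_free_cumulant p n =
     fps_nth (fps_const (- 1 / of_nat (degree p)) * fps_deriv (fps_log (cumulant_series p))) (n - 1)"

end

(* Let M = 1 + sum_n m_n(p) X^n for p of degree d, let T be the diagonal operator with
   T s^i = (d)_i / d^i s^i, and let C be the series whose logarithmic derivative defines the
   cumulants, so that X C' = - d (sum_j kappa_j X^j) C. Then T C = E = prod_i (1 - r_i X)
   satisfies X E' = - d (M - 1) E, and T X = X (1 - X D / d) T. Applying T to the equation for C and
   cancelling E gives the exact identity
     M - 1 = sum_j kappa_j A^j 1,   A f = X (M f - X f' / d).
   As d tends to infinity, A^j 1 tends coefficientwise to (X M)^j, and the coefficient of X^n in
   A^n 1 tends to 1, so kappa_n is determined recursively in the limit by M - 1 = sum_j r_j (X M)^j.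
   The free cumulants satisfy this equation too: repeatedly remove the largest element from the
   block of n in a non-crossing partition of {1..n}; each removal splits off an independent non-crossing
   partition of a gap, that is, a factor M. *)
theory Submission
  imports Defs
begin

section \<open>Free cumulants and moments\<close>

definition NC_on :: "nat set \<Rightarrow> nat set set set" where
  "NC_on A = {\<pi>. partition_on A \<pi> \<and> noncrossing \<pi>}"

lemma NC_eq_NC_on: "NC n = NC_on {1..n}"
  by (simp add: NC_def NC_on_def)

lemma finite_NC_on: "finite A \<Longrightarrow> finite (NC_on A)"
  unfolding NC_on_def by (rule finite_subset[OF _ finitely_many_partition_on[of A]]) auto

lemma noncrossingD:
  assumes "noncrossing \<pi>" "V \<in> \<pi>" "W \<in> \<pi>" "a \<in> V" "c \<in> V" "b \<in> W" "e \<in> W" "a < b" "b < c" "c < e"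
  shows "V = W"
  using assms unfolding noncrossing_def by blast

lemma noncrossing_subset: "noncrossing \<pi> \<Longrightarrow> \<rho> \<subseteq> \<pi> \<Longrightarrow> noncrossing \<rho>"
  unfolding noncrossing_def by blast

lemma noncrossing_image:
  assumes f: "strict_mono_on A f" and P: "partition_on A P" and "noncrossing P"
  shows "noncrossing ((`) f ` P)"
proof -
  have "V = W" if VW: "V \<in> P" "W \<in> P" and el: "a \<in> V" "c \<in> V" "b \<in> W" "e \<in> W"
    and lt: "f a < f b" "f b < f c" "f c < f e" for V W a b c e
  proof -
    have "a \<in> A" "b \<in> A" "c \<in> A" "e \<in> A" using partition_onD1[OF P] VW el by auto
    then have "a < b" "b < c" "c < e"
      using lt strict_mono_on_less[OF f] by auto
    then show ?thesis using noncrossingD[OF assms(3) VW el] by blast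
  qed
  then show ?thesis unfolding noncrossing_def by blast
qed

lemma NC_on_image:
  assumes f: "strict_mono_on A f" and P: "P \<in> NC_on A"
  shows "(`) f ` P \<in> NC_on (f ` A)"
proof -
  have "{} \<notin> (`) f ` P" using P by (auto simp: NC_on_def partition_on_def)
  then have "partition_on (f ` A) ((`) f ` P)"
    using partition_on_inj_image[of A P f] P strict_mono_on_imp_inj_on[OF f] by (simp add: NC_on_def)
  then show ?thesis using noncrossing_image[OF f] P by (simp add: NC_on_def)
qed

text \<open>An increasing relabelling preserves block sizes and, in both directions, the absence of
  crossings. This is what turns a gap \<open>{b<..n}\<close> into \<open>{1..n - b}\<close>.\<close>

lemma sum_mult_ext_image:
  assumes f: "strict_mono_on A f"
  shows "(\<Sum>\<pi>\<in>NC_on (f ` A). mult_ext r \<pi>) = (\<Sum>\<pi>\<in>NC_on A. mult_ext r \<pi>)"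
proof (rule sum.reindex_bij_witness[where i = "\<lambda>\<pi>. (`) f ` \<pi>" and j = "\<lambda>\<pi>. (`) (inv_into A f) ` \<pi>"])
  note inj = strict_mono_on_imp_inj_on[OF f]
  have g: "strict_mono_on (f ` A) (inv_into A f)"
    using f inj by (auto simp: strict_mono_on_def) (metis f strict_mono_on_less)
  have gf: "inv_into A f ` f ` A = A" using inj by simp
  show "(`) (inv_into A f) ` \<pi> \<in> NC_on A" if "\<pi> \<in> NC_on (f ` A)" for \<pi>
    using NC_on_image[OF g that] gf by simp
  show "(`) f ` \<pi> \<in> NC_on (f ` A)" if "\<pi> \<in> NC_on A" for \<pi> using NC_on_image[OF f that] .
  show "(`) f ` (`) (inv_into A f) ` \<pi> = \<pi>" if "\<pi> \<in> NC_on (f ` A)" for \<pi>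
  proof -
    have "f ` inv_into A f ` V = V" if "V \<in> \<pi>" for V
      using \<open>\<pi> \<in> _\<close> that by (intro image_inv_into_cancel) (auto simp: NC_on_def partition_on_def)
    then show ?thesis by (force simp: image_image)
  qed
  show "(`) (inv_into A f) ` (`) f ` \<pi> = \<pi>" if "\<pi> \<in> NC_on A" for \<pi>
  proof -
    have "inv_into A f ` f ` V = V" if "V \<in> \<pi>" for V
      using \<open>\<pi> \<in> _\<close> that by (intro inv_into_image_cancel inj) (auto simp: NC_on_def partition_on_def)
    then show ?thesis by (force simp: image_image)
  qed
  show "mult_ext r ((`) (inv_into A f) ` \<pi>) = mult_ext r \<pi>" if "\<pi> \<in> NC_on (f ` A)" for \<pi>
  proof -
    have sub: "V \<subseteq> f ` A" if "V \<in> \<pi>" for V using \<open>\<pi> \<in> _\<close> that by (auto simp: NC_on_def partition_on_def)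
    have i: "inj_on (inv_into A f) V" if "V \<in> \<pi>" for V
      using inj_on_subset[OF strict_mono_on_imp_inj_on[OF g] sub[OF that]] .
    have "inj_on ((`) (inv_into A f)) \<pi>"
      by (rule inj_on_inverseI[where g = "(`) f"]) (use sub in \<open>simp add: image_inv_into_cancel[OF refl]\<close>)
    then show ?thesis unfolding mult_ext_def
      by (subst prod.reindex) (auto intro!: prod.cong simp: card_image[OF i])
  qed
qed

section \<open>Attaching a new largest point\<close>

lemma partition_on_glue:
  assumes "partition_on {1..b} (insert V \<rho>)" "V \<notin> \<rho>" "partition_on {b<..n} \<sigma>" "b \<le> n"
  shows "partition_on {1..Suc n} (insert (insert (Suc n) V) (\<rho> \<union> \<sigma>))"
proof (rule partition_onI)
  have U: "V \<union> \<Union>\<rho> = {1..b}" "\<Union>\<sigma> = {b<..n}"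
    using assms(1,3) by (auto simp: partition_on_def)
  have "\<Union> (insert (insert (Suc n) V) (\<rho> \<union> \<sigma>)) = insert (Suc n) ((V \<union> \<Union>\<rho>) \<union> \<Union>\<sigma>)" by auto
  also have "\<dots> = {1..Suc n}" unfolding U using assms(4) by auto
  finally show "\<Union> (insert (insert (Suc n) V) (\<rho> \<union> \<sigma>)) = {1..Suc n}" .
  show "{} \<notin> insert (insert (Suc n) V) (\<rho> \<union> \<sigma>)" using assms(1,3) by (auto simp: partition_on_def)
  have sub: "p \<subseteq> {1..b}" if "p \<in> insert V \<rho>" for p using U that by blast
  have sub': "p \<subseteq> {b<..n}" if "p \<in> \<sigma>" for p using U that by blast
  have dj: "disjnt p q" if "p \<in> insert V \<rho>" "q \<in> insert V \<rho>" "p \<noteq> q" for p q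
    using assms(1) that by (auto simp: partition_on_def pairwise_def)
  have dj': "disjnt p q" if "p \<in> \<sigma>" "q \<in> \<sigma>" "p \<noteq> q" for p q
    using assms(3) that by (auto simp: partition_on_def pairwise_def)
  have x: "disjnt p q" "disjnt q p" if "p \<in> insert V \<rho>" "q \<in> \<sigma>" for p q
    using sub[OF that(1)] sub'[OF that(2)] by (fastforce simp: disjnt_def)+
  have N: "Suc n \<notin> p" if "p \<in> \<rho> \<union> \<sigma>" for p using sub[of p] sub'[of p] that assms(4) by force
  have xN: "disjnt (insert (Suc n) V) q" if "q \<in> \<rho> \<union> \<sigma>" for q
    using N[OF that] that x[of V q] dj[of V q] assms(2) by (auto simp: disjnt_insert1)
  show "disjnt p q" if "p \<in> insert (insert (Suc n) V) (\<rho> \<union> \<sigma>)" "q \<in> insert (insert (Suc n) V) (\<rho> \<union> \<sigma>)" "p \<noteq> q"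
    for p q
    using that xN dj dj' x by (metis UnE disjnt_sym insert_iff)
qed

text \<open>Blocks in \<open>{1..b}\<close> and blocks in \<open>{b<..n}\<close> are separated by
  position. The old points of the enlarged block all lie to the left of the gap, so it crosses no
  gap block either. A crossing that uses \<open>Suc n\<close> already occurs in the old partition,
  with \<open>b\<close> in its place.\<close>

lemma noncrossing_glue:
  assumes P: "partition_on {1..b} (insert V \<rho>)" and V: "V \<notin> \<rho>" "b \<in> V"
    and Q: "partition_on {b<..n} \<sigma>"
    and nc: "noncrossing (insert V \<rho>)" "noncrossing \<sigma>" and "b \<le> n"
  shows "noncrossing (insert (insert (Suc n) V) (\<rho> \<union> \<sigma>))"
proof -
  let ?\<pi> = "insert (insert (Suc n) V) (\<rho> \<union> \<sigma>)"
  have U: "V \<union> \<Union>\<rho> = {1..b}" "\<Union>\<sigma> = {b<..n}"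
    using P Q by (auto simp: partition_on_def)
  have le: "x \<le> b" if "p \<in> insert V \<rho>" "x \<in> p" for p x using U that by auto
  have gt: "b < x" "x \<le> n" if "p \<in> \<sigma>" "x \<in> p" for p x using U that by auto
  have bV: "b \<notin> p" if "p \<in> \<rho>" for p 
    using partition_onD2[OF P] that V by (metis disjnt_iff insertI1 insertI2 pairwiseD)
  have False if xs: "a < x" "x < c" "c < e" and VW: "X \<in> ?\<pi>" "Y \<in> ?\<pi>" "X \<noteq> Y"
    and el: "a \<in> X" "c \<in> X" "x \<in> Y" "e \<in> Y" for a x c e X Y
  proof -
    have bound: "z \<le> Suc n" if "z \<in> p" "p \<in> ?\<pi>" for z p
      using that le[of p z] gt(2)[of p z] le[of V z] \<open>b \<le> n\<close> by force
    have "e \<le> Suc n" using bound[OF el(4) VW(2)] .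
    then have notN: "a \<noteq> Suc n" "x \<noteq> Suc n" "c \<noteq> Suc n" using xs by auto
    consider (1) "X = insert (Suc n) V" "Y \<in> \<rho>" | (2) "X = insert (Suc n) V" "Y \<in> \<sigma>"
      | (3) "Y = insert (Suc n) V" "X \<in> \<rho>" | (4) "Y = insert (Suc n) V" "X \<in> \<sigma>"
      | (5) "X \<in> \<rho>" "Y \<in> \<rho>" | (6) "X \<in> \<rho>" "Y \<in> \<sigma>" | (7) "X \<in> \<sigma>" "Y \<in> \<rho>" | (8) "X \<in> \<sigma>" "Y \<in> \<sigma>"
      using VW by auto
    then show False
    proof cases
      case 1
      then show False using noncrossingD[OF nc(1), of V Y a c x e] xs el notN V by auto
    next
      case 2
      then show False using le[of V c] gt[of Y x] el xs notN by force
    next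
      case 3
      \<comment> \<open>\<open>e\<close> may be \<open>Suc n\<close>; it is replaced by
        \<open>b\<close>, which lies in \<open>V\<close> and to the right of
        \<open>c\<close>.\<close>
      have "c < b" using le[of X c] bV[of X] 3 el by (metis insertI2 le_neq_implies_less)
      then show False using noncrossingD[OF nc(1), of X V a c x b] 3 xs el notN V by auto
    next
      case 4
      then show False using le[of V x] gt[of X a] el xs notN by force
    next
      case 5
      then show False using noncrossingD[OF nc(1), of X Y a c x e] xs el VW(3) by auto
    next
      case 6
      then show False using le[of X c] gt[of Y x] el xs by force
    next
      case 7
      then show False using gt[of X a] le[of Y x] el xs by force
    next
      case 8
      then show False using noncrossingD[OF nc(2), of X Y a c x e] xs el VW(3) by auto
    qed
  qed
  then show ?thesis unfolding noncrossing_def by blast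
qed

lemma noncrossing_insert_singleton:
  assumes "noncrossing \<sigma>" shows "noncrossing (insert {x} \<sigma>)"
proof -
  have "V = W" if "V \<in> insert {x} \<sigma>" "W \<in> insert {x} \<sigma>" "a \<in> V" "c \<in> V" "b \<in> W" "e \<in> W"
    "a < b" "b < c" "c < e" for V W a b c e
  proof -
    have "V \<noteq> {x}" "W \<noteq> {x}" using that by auto
    then show ?thesis using noncrossingD[OF assms, of V W a c b e] that by blast
  qed
  then show ?thesis unfolding noncrossing_def by blast
qed

section \<open>Splitting by the predecessor of the last point\<close>

text \<open>The index \<open>b\<close> is the predecessor of \<open>n + 1\<close> in its block, or \<open>0\<close> if \<open>n + 1\<close> is the smallest element.\<close>
definition NC_prev :: "nat \<Rightarrow> nat \<Rightarrow> nat set set set" where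
  "NC_prev n b = {\<pi> \<in> NC (Suc n). \<exists>V\<in>\<pi>. Suc n \<in> V \<and> V \<inter> {b<..n} = {} \<and> (b = 0 \<or> b \<in> V)}"

lemma partition_on_same_block:
  assumes "partition_on A P" "V \<in> P" "W \<in> P" "x \<in> V" "x \<in> W" shows "V = W"
  using partition_onD2[OF assms(1)] assms(2-5) by (metis disjnt_iff pairwiseD)

lemma NC_Suc_eq_UN: "NC (Suc n) = (\<Union>b\<in>{..n}. NC_prev n b)"
proof
  show "(\<Union>b\<in>{..n}. NC_prev n b) \<subseteq> NC (Suc n)" by (auto simp: NC_prev_def)
  show "NC (Suc n) \<subseteq> (\<Union>b\<in>{..n}. NC_prev n b)"
  proof
    fix \<pi> assume pi: "\<pi> \<in> NC (Suc n)"
    then have U: "\<Union>\<pi> = {1..Suc n}" by (simp add: NC_def partition_on_def)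
    then obtain V where V: "V \<in> \<pi>" "Suc n \<in> V" by (metis UnionE atLeastAtMost_iff le_add1 order_refl plus_1_eq_Suc)
    have sub: "V \<subseteq> {1..Suc n}" using U V by blast
    \<comment> \<open>Adjoining \<open>0\<close> makes the set nonempty and gives the maximum
      \<open>0\<close> exactly when \<open>Suc n\<close> is alone in its block.\<close>
    define T where "T = insert 0 (V - {Suc n})"
    have fin: "finite T" using finite_subset[OF sub] by (simp add: T_def)
    have "T \<subseteq> {..n}" using sub by (auto simp: T_def le_Suc_eq)
    moreover have mT: "Max T \<in> T" using Max_in[OF fin] by (simp add: T_def)
    ultimately have "Max T \<le> n" by blast
    moreover have "V \<inter> {Max T<..n} = {}"
    proof -
      have False if "x \<in> V" "Max T < x" "x \<le> n" for x
        using Max_ge[OF fin, of x] that by (simp add: T_def)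
      then show ?thesis by fastforce
    qed
    moreover have "Max T = 0 \<or> Max T \<in> V" using mT by (auto simp: T_def)
    ultimately show "\<pi> \<in> (\<Union>b\<in>{..n}. NC_prev n b)" using V pi unfolding NC_prev_def by blast
  qed
qed

text \<open>A larger \<open>b'\<close> would lie in the block of \<open>Suc n\<close>, inside the
  range that \<open>b\<close> leaves empty. Applied in both directions, this makes the classes
  disjoint.\<close>

lemma NC_prev_unique:
  assumes "\<pi> \<in> NC_prev n b" "\<pi> \<in> NC_prev n b'" "b \<le> n" "b' \<le> n"
  shows "b' \<le> b"
proof (rule ccontr)
  assume less: "\<not> b' \<le> b"
  obtain V where V: "V \<in> \<pi>" "Suc n \<in> V" "V \<inter> {b<..n} = {}" using assms(1) by (auto simp: NC_prev_def)
  obtain V' where V': "V' \<in> \<pi>" "Suc n \<in> V'" "b' = 0 \<or> b' \<in> V'" using assms(2) by (auto simp: NC_prev_def)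
  have "partition_on {1..Suc n} \<pi>" using assms(1) by (simp add: NC_prev_def NC_def)
  then have "V = V'" using partition_on_same_block V V' by metis
  then have "b' \<in> V \<inter> {b<..n}" using V' less assms(4) by auto
  then show False using V by blast
qed

lemma sum_NC_Suc: "(\<Sum>\<pi>\<in>NC (Suc n). f \<pi>) = (\<Sum>b\<le>n. \<Sum>\<pi>\<in>NC_prev n b. f \<pi>)"
  unfolding NC_Suc_eq_UN
proof (rule sum.UNION_disjoint)
  show "\<forall>b\<in>{..n}. finite (NC_prev n b)"
    using finite_NC_on[of "{1..Suc n}"] by (simp add: NC_prev_def NC_eq_NC_on)
  show "\<forall>b\<in>{..n}. \<forall>b'\<in>{..n}. b \<noteq> b' \<longrightarrow> NC_prev n b \<inter> NC_prev n b' = {}"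
    using NC_prev_unique by (metis atMost_iff disjoint_iff order_antisym)
qed simp

text \<open>For \<open>b = 0\<close> the excluded range is all of \<open>{1..n}\<close>, so the
  block of \<open>Suc n\<close> is a singleton, and a singleton takes part in no crossing.\<close>

lemma NC_prev_zero: "NC_prev n 0 = insert {Suc n} ` NC n"
proof
  show "insert {Suc n} ` NC n \<subseteq> NC_prev n 0"
  proof
    fix \<pi> assume "\<pi> \<in> insert {Suc n} ` NC n"
    then obtain \<sigma> where s: "\<pi> = insert {Suc n} \<sigma>" "partition_on {1..n} \<sigma>" "noncrossing \<sigma>"
      by (auto simp: NC_def)
    have "Suc n \<notin> \<Union>\<sigma>" unfolding partition_onD1[OF s(2), symmetric] by simp
    then have "disjnt {Suc n} (\<Union>\<sigma>)" by (simp add: disjnt_iff)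
    moreover have "{1..Suc n} - {Suc n} = {1..n}" by auto
    ultimately have "partition_on {1..Suc n} \<pi>" using s partition_on_insert[of "{Suc n}" \<sigma> "{1..Suc n}"] by simp
    then show "\<pi> \<in> NC_prev n 0" using s noncrossing_insert_singleton by (auto simp: NC_prev_def NC_def)
  qed
  show "NC_prev n 0 \<subseteq> insert {Suc n} ` NC n"
  proof
    fix \<pi> assume pi: "\<pi> \<in> NC_prev n 0"
    then have P: "partition_on {1..Suc n} \<pi>" "noncrossing \<pi>" by (auto simp: NC_prev_def NC_def)
    obtain V where V: "V \<in> \<pi>" "Suc n \<in> V" "V \<inter> {0<..n} = {}" using pi by (auto simp: NC_prev_def)
    have "V \<subseteq> {1..Suc n}" using partition_onD1[OF P(1)] V by blast
    then have "V = {Suc n}" using V(2,3) by (fastforce simp: le_Suc_eq)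
    then have eq: "\<pi> = insert {Suc n} (\<pi> - {{Suc n}})" using V by blast
    have "disjnt {Suc n} W" if "W \<in> \<pi> - {{Suc n}}" for W
      using partition_onD2[OF P(1)] that V \<open>V = _\<close> by (metis DiffE insertI1 pairwiseD)
    then have "disjnt {Suc n} (\<Union>(\<pi> - {{Suc n}}))" by (auto simp: disjnt_iff)
    moreover have "{1..Suc n} - {Suc n} = {1..n}" by auto
    ultimately have "partition_on {1..n} (\<pi> - {{Suc n}})"
      using P(1) eq partition_on_insert[of "{Suc n}" "\<pi> - {{Suc n}}" "{1..Suc n}"] by simp
    then have "\<pi> - {{Suc n}} \<in> NC n" using noncrossing_subset[OF P(2)] by (auto simp: NC_def)
    then show "\<pi> \<in> insert {Suc n} ` NC n" using eq by blast
  qed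
qed

lemma NC_no_Suc_block:
  assumes "\<sigma> \<in> NC n" "V \<in> \<sigma>" shows "Suc n \<notin> V"
proof -
  have "{1..n} = \<Union>\<sigma>" using assms(1) partition_onD1 by (auto simp only: NC_def)
  then have "V \<subseteq> {1..n}" using assms(2) by blast
  then show ?thesis by auto
qed

lemma finite_NC_member: "\<sigma> \<in> NC n \<Longrightarrow> finite \<sigma>"
  using finite_elements[of "{1..n}"] by (auto simp: NC_def)

section \<open>Weights and the recursion from peeling off the last point\<close>

text \<open>Raising the index of the block of \<open>n\<close> by \<open>k\<close> accounts for \<open>k\<close> larger elements of that block which
  have already been peeled off; \<open>n = 0\<close> means that the block consists of these elements alone.\<close>
definition shifted_ext :: "(nat \<Rightarrow> complex) \<Rightarrow> nat \<Rightarrow> nat \<Rightarrow> nat set set \<Rightarrow> complex" where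
  "shifted_ext r k n \<pi> = (\<Prod>V\<in>\<pi>. r (card V + (if n \<in> V then k else 0)))"

definition shifted_moment :: "(nat \<Rightarrow> complex) \<Rightarrow> nat \<Rightarrow> nat \<Rightarrow> complex" where
  "shifted_moment r k n = (if n = 0 then r k else \<Sum>\<pi>\<in>NC n. shifted_ext r k n \<pi>)"

text \<open>The block \<open>{Suc n}\<close> has shifted size \<open>1 + k\<close>; the other blocks
  do not contain \<open>Suc n\<close> and keep their plain weights.\<close>

lemma sum_NC_prev_zero:
  "(\<Sum>\<pi>\<in>NC_prev n 0. shifted_ext r k (Suc n) \<pi>) = r (Suc k) * (\<Sum>\<sigma>\<in>NC n. mult_ext r \<sigma>)"
proof -
  have "inj_on (insert {Suc n}) (NC n)"
  proof (rule inj_onI)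
    fix \<sigma> \<tau> assume *: "\<sigma> \<in> NC n" "\<tau> \<in> NC n" "insert {Suc n} \<sigma> = insert {Suc n} \<tau>"
    then have "{Suc n} \<notin> \<sigma>" "{Suc n} \<notin> \<tau>" using NC_no_Suc_block by blast+
    then show "\<sigma> = \<tau>" using *(3) by (metis insert_ident)
  qed
  moreover have "shifted_ext r k (Suc n) (insert {Suc n} \<sigma>) = r (Suc k) * mult_ext r \<sigma>" if "\<sigma> \<in> NC n" for \<sigma>
  proof -
    have "{Suc n} \<notin> \<sigma>" using NC_no_Suc_block that by blast
    then show ?thesis using finite_NC_member[OF that] NC_no_Suc_block[OF that]
      by (simp add: shifted_ext_def mult_ext_def)
  qed
  ultimately show ?thesis unfolding NC_prev_zero by (simp add: sum.reindex sum_distrib_left)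
qed

text \<open>One direction of the bijection between \<open>NC b \<times> NC_on {b<..n}\<close> and
  \<open>NC_prev n b\<close>. The positional facts about the blocks allow the two parts to be told
  apart again.\<close>

lemma NC_glue:
  assumes "\<tau> \<in> NC b" "\<sigma> \<in> NC_on {b<..n}" "0 < b" "b \<le> n"
  obtains V \<rho> where "\<tau> = insert V \<rho>" "V \<notin> \<rho>" "b \<in> V" "V \<subseteq> {1..b}"
    "\<And>W. W \<in> \<rho> \<Longrightarrow> b \<notin> W \<and> W \<subseteq> {1..b} \<and> W \<noteq> {}"
    "\<And>W. W \<in> \<sigma> \<Longrightarrow> W \<subseteq> {b<..n} \<and> W \<noteq> {}"
    "insert (insert (Suc n) V) (\<rho> \<union> \<sigma>) \<in> NC_prev n b"
proof -
  have P: "partition_on {1..b} \<tau>" "noncrossing \<tau>" and Q: "partition_on {b<..n} \<sigma>" "noncrossing \<sigma>"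
    using assms by (auto simp: NC_def NC_on_def)
  have U: "\<Union>\<tau> = {1..b}" using P by (simp add: partition_on_def)
  then obtain V where V: "V \<in> \<tau>" "b \<in> V" using assms(3) by (metis UnionE atLeastAtMost_iff One_nat_def Suc_leI order_refl)
  define \<rho> where "\<rho> = \<tau> - {V}"
  have t: "\<tau> = insert V \<rho>" "V \<notin> \<rho>" using V by (auto simp: \<rho>_def)
  have 1: "V \<subseteq> {1..b}" using U V by blast
  have 2: "b \<notin> W \<and> W \<subseteq> {1..b} \<and> W \<noteq> {}" if "W \<in> \<rho>" for W
  proof -
    have W: "W \<in> \<tau>" "W \<noteq> V" using that by (auto simp: \<rho>_def)
    then have "b \<notin> W" using partition_on_same_block[OF P(1)] V by metis
    then show ?thesis using U W partition_onD3[OF P(1)] by blast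
  qed
  have 3: "W \<subseteq> {b<..n} \<and> W \<noteq> {}" if "W \<in> \<sigma>" for W
    using Q(1) that by (auto simp: partition_on_def)
  have "insert (insert (Suc n) V) (\<rho> \<union> \<sigma>) \<in> NC (Suc n)"
    unfolding NC_def using partition_on_glue[of b V \<rho> n \<sigma>] noncrossing_glue[of b V \<rho> n \<sigma>] P Q V assms(4) t by auto
  moreover have "insert (Suc n) V \<inter> {b<..n} = {}" using 1 by auto
  ultimately have "insert (insert (Suc n) V) (\<rho> \<union> \<sigma>) \<in> NC_prev n b"
    using V unfolding NC_prev_def by blast
  then show thesis using that t V 1 2 3 by blast
qed

text \<open>The inverse direction. A block other than that of \<open>Suc n\<close> stays on one side
  of \<open>b\<close>, since otherwise it would cross the block containing \<open>b\<close> and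
  \<open>Suc n\<close>.\<close>

lemma NC_unglue:
  assumes "\<pi> \<in> NC_prev n b" "0 < b" "b \<le> n"
  obtains V \<rho> \<sigma> where "\<pi> = insert (insert (Suc n) V) (\<rho> \<union> \<sigma>)" "b \<in> V" "V \<subseteq> {1..b}"
    "\<And>W. W \<in> \<rho> \<Longrightarrow> b \<notin> W \<and> W \<subseteq> {1..b} \<and> W \<noteq> {}"
    "\<And>W. W \<in> \<sigma> \<Longrightarrow> W \<subseteq> {b<..n} \<and> W \<noteq> {}"
    "insert V \<rho> \<in> NC b" "\<sigma> \<in> NC_on {b<..n}"
proof -
  have P: "partition_on {1..Suc n} \<pi>" "noncrossing \<pi>" using assms(1) by (auto simp: NC_prev_def NC_def)
  have U: "\<Union>\<pi> = {1..Suc n}" using P by (simp add: partition_on_def)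
  obtain V0 where V0: "V0 \<in> \<pi>" "Suc n \<in> V0" "V0 \<inter> {b<..n} = {}" "b \<in> V0"
    using assms by (auto simp: NC_prev_def)
  define V \<rho> \<sigma> where "V = V0 - {Suc n}" and "\<rho> = {W \<in> \<pi>. W \<noteq> V0 \<and> W \<subseteq> {1..b}}"
    and "\<sigma> = {W \<in> \<pi>. W \<subseteq> {b<..n}}"
  have insV: "insert (Suc n) V = V0" using V0 by (auto simp: V_def)
  have nb: "b \<notin> W" "Suc n \<notin> W" if "W \<in> \<pi>" "W \<noteq> V0" for W
    using partition_on_same_block[OF P(1)] V0 that by metis+
  have sub: "W \<subseteq> {1..Suc n}" if "W \<in> \<pi>" for W using U that by blast
  have dich: "W \<subseteq> {1..b} \<or> W \<subseteq> {b<..n}" if W: "W \<in> \<pi>" "W \<noteq> V0" for W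
  proof (rule ccontr)
    assume "\<not> ?thesis"
    then obtain x y where x: "x \<in> W" "x \<notin> {1..b}" and y: "y \<in> W" "y \<notin> {b<..n}" by blast
    have "x \<in> {1..Suc n}" "y \<in> {1..Suc n}" using sub[OF W(1)] x y by auto
    moreover have "x \<noteq> Suc n" "y \<noteq> Suc n" "y \<noteq> b" using nb[OF W] x y by auto
    ultimately have "y < b" "b < x" "x < Suc n" using x y by auto
    then show False using noncrossingD[OF P(2) W(1) V0(1) y(1) x(1) V0(4,2)] W by blast
  qed
  have Vsub: "V \<subseteq> {1..b}"
  proof
    fix x assume x: "x \<in> V"
    then have "x \<in> {1..Suc n}" "x \<noteq> Suc n" "x \<notin> {b<..n}" using sub[OF V0(1)] V0(3) by (auto simp: V_def)
    then show "x \<in> {1..b}" by auto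
  qed
  have bV: "b \<in> V" using V0 assms(3) by (auto simp: V_def)
  have rho: "b \<notin> W \<and> W \<subseteq> {1..b} \<and> W \<noteq> {}" if "W \<in> \<rho>" for W
    using nb[of W] partition_onD3[OF P(1)] that by (auto simp: \<rho>_def)
  have sig: "W \<subseteq> {b<..n} \<and> W \<noteq> {}" if "W \<in> \<sigma>" for W
    using partition_onD3[OF P(1)] that by (auto simp: \<sigma>_def)
  have eq: "\<pi> = insert (insert (Suc n) V) (\<rho> \<union> \<sigma>)"
    unfolding insV using dich V0(1) by (auto simp: \<rho>_def \<sigma>_def)
  have "partition_on {b<..n} \<sigma>"
  proof (rule partition_onI)
    show "{} \<notin> \<sigma>" using sig by blast
    show "disjnt p q" if "p \<in> \<sigma>" "q \<in> \<sigma>" "p \<noteq> q" for p q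
      using partition_onD2[OF P(1)] that by (auto simp: \<sigma>_def pairwise_def)
    show "\<Union>\<sigma> = {b<..n}"
    proof
      show "\<Union>\<sigma> \<subseteq> {b<..n}" by (auto simp: \<sigma>_def)
      show "{b<..n} \<subseteq> \<Union>\<sigma>"
      proof
        fix x assume x: "x \<in> {b<..n}"
        then have "x \<in> \<Union>\<pi>" using U by auto
        then obtain W where W: "W \<in> \<pi>" "x \<in> W" by blast
        then have "W \<noteq> V0" "\<not> W \<subseteq> {1..b}" using x V0(3) by auto
        then show "x \<in> \<Union>\<sigma>" using dich[of W] W by (auto simp: \<sigma>_def)
      qed
    qed
  qed
  then have sNC: "\<sigma> \<in> NC_on {b<..n}"
    using noncrossing_subset[OF P(2)] by (auto simp: NC_on_def \<sigma>_def)
  have "partition_on {1..b} (insert V \<rho>)"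
  proof (rule partition_onI)
    show "{} \<notin> insert V \<rho>" using rho bV by blast
    have "disjnt V q" if "q \<in> \<rho>" for q
      using partition_onD2[OF P(1)] that V0(1) by (auto simp: \<rho>_def V_def pairwise_def disjnt_iff)
    moreover have "disjnt p q" if "p \<in> \<rho>" "q \<in> \<rho>" "p \<noteq> q" for p q
      using partition_onD2[OF P(1)] that by (auto simp: \<rho>_def pairwise_def)
    ultimately show "disjnt p q" if "p \<in> insert V \<rho>" "q \<in> insert V \<rho>" "p \<noteq> q" for p q
      using that by (metis disjnt_sym insertE)
    show "\<Union>(insert V \<rho>) = {1..b}"
    proof
      show "\<Union>(insert V \<rho>) \<subseteq> {1..b}" using Vsub by (auto simp: \<rho>_def)
      show "{1..b} \<subseteq> \<Union>(insert V \<rho>)"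
      proof
        fix x assume x: "x \<in> {1..b}"
        then have "x \<in> \<Union>\<pi>" "x \<noteq> Suc n" using U assms(3) by auto
        then obtain W where W: "W \<in> \<pi>" "x \<in> W" by blast
        show "x \<in> \<Union>(insert V \<rho>)"
        proof (cases "W = V0")
          case True
          then show ?thesis using W \<open>x \<noteq> Suc n\<close> by (auto simp: V_def)
        next
          case False
          moreover have "\<not> W \<subseteq> {b<..n}" using x W by auto
          ultimately show ?thesis using dich[of W] W by (auto simp: \<rho>_def)
        qed
      qed
    qed
  qed
  moreover have "noncrossing (insert V \<rho>)"
  proof -
    \<comment> \<open>\<open>h\<close> sends a block of the cut partition to the block of
      \<open>\<pi>\<close> that it came from. It is injective and only enlarges blocks, so a
      crossing would persist in \<open>\<pi>\<close>.\<close>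
    define h where "h X = (if X = V then V0 else X)" for X
    have h: "h X \<in> \<pi>" "X \<subseteq> h X" if "X \<in> insert V \<rho>" for X
      using that V0 by (auto simp: h_def \<rho>_def V_def)
    have inj: "X = Y" if "X \<in> insert V \<rho>" "Y \<in> insert V \<rho>" "h X = h Y" for X Y
      using that by (auto simp: h_def \<rho>_def split: if_splits)
    have "X = Y" if "X \<in> insert V \<rho>" "Y \<in> insert V \<rho>" "a \<in> X" "c \<in> X" "x \<in> Y" "e \<in> Y"
      "a < x" "x < c" "c < e" for X Y a x c e
      using noncrossingD[OF P(2) h(1)[OF that(1)] h(1)[OF that(2)], of a c x e] that(3-)
        h(2)[OF that(1)] h(2)[OF that(2)] inj[OF that(1,2)] by blast
    then show ?thesis unfolding noncrossing_def by blast
  qed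
  ultimately have "insert V \<rho> \<in> NC b" by (simp add: NC_def)
  then show thesis using that eq bV Vsub rho sig sNC by blast
qed

text \<open>Removing \<open>Suc n\<close> shrinks the block of \<open>b\<close> by one, and the
  shift \<open>Suc k\<close> compensates for this. Gap blocks do not contain \<open>Suc n\<close>
  and so carry plain weights.\<close>

lemma sum_NC_prev_pos:
  assumes "0 < b" "b \<le> n"
  shows "(\<Sum>\<pi>\<in>NC_prev n b. shifted_ext r k (Suc n) \<pi>) =
    (\<Sum>\<tau>\<in>NC b. shifted_ext r (Suc k) b \<tau>) * (\<Sum>\<sigma>\<in>NC_on {b<..n}. mult_ext r \<sigma>)"
proof -
  define glue where "glue = (\<lambda>(\<tau>, \<sigma>). (\<lambda>V. if b \<in> V then insert (Suc n) V else V) ` \<tau> \<union> \<sigma>)"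
  \<comment> \<open>Gap blocks are recognised as those inside \<open>{b<..n}\<close>; the block of
    \<open>Suc n\<close> is not one of them.\<close>
  define cut where "cut \<pi> = ((\<lambda>V. V - {Suc n}) ` {V \<in> \<pi>. \<not> V \<subseteq> {b<..n}}, {V \<in> \<pi>. V \<subseteq> {b<..n}})" for \<pi>
  have glue: "glue (insert V \<rho>, \<sigma>) = insert (insert (Suc n) V) (\<rho> \<union> \<sigma>)"
    if "b \<in> V" "\<And>W. W \<in> \<rho> \<Longrightarrow> b \<notin> W \<and> W \<subseteq> {1..b} \<and> W \<noteq> {}" for V \<rho> \<sigma>
  proof -
    have "(\<lambda>V. if b \<in> V then insert (Suc n) V else V) ` \<rho> = (\<lambda>V. V) ` \<rho>"
      using that by (intro image_cong) auto
    then have "(\<lambda>V. if b \<in> V then insert (Suc n) V else V) ` insert V \<rho> = insert (insert (Suc n) V) \<rho>"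
      using that(1) by (simp only: image_insert image_ident if_True)
    then show ?thesis by (simp add: glue_def del: image_insert)
  qed
  have cut: "cut (insert (insert (Suc n) V) (\<rho> \<union> \<sigma>)) = (insert V \<rho>, \<sigma>)"
    if V: "V \<subseteq> {1..b}" and R: "\<And>W. W \<in> \<rho> \<Longrightarrow> b \<notin> W \<and> W \<subseteq> {1..b} \<and> W \<noteq> {}"
      and S: "\<And>W. W \<in> \<sigma> \<Longrightarrow> W \<subseteq> {b<..n} \<and> W \<noteq> {}" for V \<rho> \<sigma>
  proof -
    have n: "\<not> W \<subseteq> {b<..n}" "Suc n \<notin> W" if W: "W \<in> \<rho>" for W
    proof -
      obtain x where "x \<in> W" using R[OF W] by blast
      then have "x \<le> b" using R[OF W] by auto
      then show "\<not> W \<subseteq> {b<..n}" using \<open>x \<in> W\<close> by auto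
      show "Suc n \<notin> W" using R[OF W] assms(2) by auto
    qed
    let ?\<pi> = "insert (insert (Suc n) V) (\<rho> \<union> \<sigma>)"
    have "{V \<in> ?\<pi>. V \<subseteq> {b<..n}} = \<sigma>" using S n by auto
    moreover have "{V \<in> ?\<pi>. \<not> V \<subseteq> {b<..n}} = insert (insert (Suc n) V) \<rho>" using S n by auto
    moreover have "(\<lambda>V. V - {Suc n}) ` \<rho> = (\<lambda>V. V) ` \<rho>" using n by (intro image_cong) auto
    moreover have "insert (Suc n) V - {Suc n} = V" using V assms(2) by auto
    ultimately show ?thesis by (simp add: cut_def)
  qed
  have ext: "shifted_ext r k (Suc n) (insert (insert (Suc n) V) (\<rho> \<union> \<sigma>)) =
      shifted_ext r (Suc k) b (insert V \<rho>) * mult_ext r \<sigma>"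
    if V: "b \<in> V" "V \<subseteq> {1..b}" and R: "\<And>W. W \<in> \<rho> \<Longrightarrow> b \<notin> W \<and> W \<subseteq> {1..b} \<and> W \<noteq> {}"
      and S: "\<And>W. W \<in> \<sigma> \<Longrightarrow> W \<subseteq> {b<..n} \<and> W \<noteq> {}" and fin: "finite \<rho>" "finite \<sigma>" for V \<rho> \<sigma>
  proof -
    have N: "Suc n \<notin> V" "finite V" using V(2) assms(2) finite_subset by auto
    have N': "Suc n \<notin> W" if "W \<in> \<rho> \<union> \<sigma>" for W
    proof -
      have "W \<subseteq> {1..b} \<or> W \<subseteq> {b<..n}"
        using that R S by blast
      then show ?thesis using assms(2) by auto
    qed
    have "\<rho> \<inter> \<sigma> = {}" using R S by fastforce
    moreover have "insert (Suc n) V \<notin> \<rho> \<union> \<sigma>" using N' by blast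
    moreover have "V \<notin> \<rho>" using R V by blast
    ultimately show ?thesis using V R fin N N'
      by (simp add: shifted_ext_def mult_ext_def prod.union_disjoint mult.assoc)
  qed
  have "(\<Sum>\<pi>\<in>NC_prev n b. shifted_ext r k (Suc n) \<pi>) =
    (\<Sum>(\<tau>, \<sigma>)\<in>NC b \<times> NC_on {b<..n}. shifted_ext r (Suc k) b \<tau> * mult_ext r \<sigma>)"
  proof (rule sum.reindex_bij_witness[where i = glue and j = cut])
    fix \<pi> assume pi: "\<pi> \<in> NC_prev n b"
    then obtain V \<rho> \<sigma> where *: "\<pi> = insert (insert (Suc n) V) (\<rho> \<union> \<sigma>)" "b \<in> V" "V \<subseteq> {1..b}"
        "\<And>W. W \<in> \<rho> \<Longrightarrow> b \<notin> W \<and> W \<subseteq> {1..b} \<and> W \<noteq> {}"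
        "\<And>W. W \<in> \<sigma> \<Longrightarrow> W \<subseteq> {b<..n} \<and> W \<noteq> {}"
        "insert V \<rho> \<in> NC b" "\<sigma> \<in> NC_on {b<..n}"
      using NC_unglue assms by metis
    have c: "cut \<pi> = (insert V \<rho>, \<sigma>)" unfolding *(1) by (rule cut[OF *(3,4,5)])
    show "glue (cut \<pi>) = \<pi>" unfolding c unfolding *(1) by (rule glue[OF *(2,4)])
    show "cut \<pi> \<in> NC b \<times> NC_on {b<..n}" using c * by simp
    have "finite \<pi>" using pi finite_NC_member by (auto simp: NC_prev_def)
    then have "finite \<rho>" "finite \<sigma>" using *(1) by auto
    then show "(case cut \<pi> of (\<tau>, \<sigma>) \<Rightarrow> shifted_ext r (Suc k) b \<tau> * mult_ext r \<sigma>) = shifted_ext r k (Suc n) \<pi>"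
      using ext[OF *(2-5)] c *(1) by simp
  next
    fix x assume "x \<in> NC b \<times> NC_on {b<..n}"
    then obtain \<tau> \<sigma> where x: "x = (\<tau>, \<sigma>)" "\<tau> \<in> NC b" "\<sigma> \<in> NC_on {b<..n}" by blast
    obtain V \<rho> where *: "\<tau> = insert V \<rho>" "V \<notin> \<rho>" "b \<in> V" "V \<subseteq> {1..b}"
        "\<And>W. W \<in> \<rho> \<Longrightarrow> b \<notin> W \<and> W \<subseteq> {1..b} \<and> W \<noteq> {}"
        "\<And>W. W \<in> \<sigma> \<Longrightarrow> W \<subseteq> {b<..n} \<and> W \<noteq> {}"
        "insert (insert (Suc n) V) (\<rho> \<union> \<sigma>) \<in> NC_prev n b"
      using NC_glue[OF x(2,3) assms] by metis
    have g: "glue x = insert (insert (Suc n) V) (\<rho> \<union> \<sigma>)" unfolding x(1) *(1) by (rule glue[OF *(3,5)])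
    show "glue x \<in> NC_prev n b" using g * by simp
    show "cut (glue x) = x" unfolding g unfolding x(1) *(1) by (rule cut[OF *(4,5,6)])
  qed
  then show ?thesis by (simp add: sum_product sum.cartesian_product)
qed

text \<open>Sum over the predecessor \<open>b\<close>; the gap has \<open>n - b\<close> points. For
  \<open>b = 0\<close> the factor \<open>shifted_moment r (Suc k) 0 = r (Suc k)\<close> comes from
  the singleton block.\<close>

lemma shifted_moment_Suc:
  "shifted_moment r k (Suc n) =
    (\<Sum>b\<le>n. shifted_moment r (Suc k) b * (\<Sum>\<sigma>\<in>NC (n - b). mult_ext r \<sigma>))"
proof -
  have "(\<Sum>\<pi>\<in>NC_prev n b. shifted_ext r k (Suc n) \<pi>) =
    shifted_moment r (Suc k) b * (\<Sum>\<sigma>\<in>NC (n - b). mult_ext r \<sigma>)" if "b \<le> n" for b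
  proof (cases "b = 0")
    case True
    then show ?thesis by (simp add: sum_NC_prev_zero shifted_moment_def)
  next
    case False
    have "(+) b ` {1..n - b} = {b<..n}"
      using that by (subst image_add_atLeastAtMost) auto
    then have "(\<Sum>\<sigma>\<in>NC_on {b<..n}. mult_ext r \<sigma>) = (\<Sum>\<sigma>\<in>NC (n - b). mult_ext r \<sigma>)"
      using sum_mult_ext_image[of "{1..n - b}" "(+) b" r]
      by (simp add: NC_eq_NC_on strict_mono_on_def)
    then show ?thesis using sum_NC_prev_pos[of b n r k] that False by (simp add: shifted_moment_def)
  qed
  then show ?thesis by (simp add: shifted_moment_def sum_NC_Suc)
qed

section \<open>Generating functions and the functional equation of the free cumulants\<close>

definition moment_fps :: "(nat \<Rightarrow> complex) \<Rightarrow> complex fps" where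
  "moment_fps m = Abs_fps (\<lambda>n. if n = 0 then 1 else m n)"

text \<open>In terms of series the recursion is \<open>W k = r k + X M W (k + 1)\<close>. Iterating
  it from \<open>k = 0\<close>, where the weights are unshifted, expands the moments in powers of
  \<open>X M\<close>.\<close>

lemma moment_eq_sum_free_cumulants:
  assumes "free_cumulants_of m r" "n > 0"
  shows "m n = (\<Sum>j=1..n. r j * ((fps_X * moment_fps m) ^ j) $ n)"
proof -
  define M where "M = moment_fps m"
  define W where "W k = Abs_fps (shifted_moment r k)" for k
  \<comment> \<open>The empty partition has weight \<open>1\<close>, which matches the constant
    coefficient chosen for \<open>M\<close>.\<close>
  have "NC 0 = {{}}" by (auto simp: NC_def partition_on_empty noncrossing_def)
  then have M: "M $ i = (\<Sum>\<sigma>\<in>NC i. mult_ext r \<sigma>)" for i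
    using assms(1) by (cases i) (auto simp: M_def moment_fps_def free_cumulants_of_def mult_ext_def)
  have rec: "W k = fps_const (r k) + fps_X * M * W (Suc k)" for k
  proof (rule fps_ext)
    fix i show "W k $ i = (fps_const (r k) + fps_X * M * W (Suc k)) $ i"
    proof (cases i)
      case 0
      then show ?thesis by (simp add: W_def shifted_moment_def mult.assoc)
    next
      case (Suc l)
      have "W k $ Suc l = (W (Suc k) * M) $ l"
        by (simp add: W_def shifted_moment_Suc fps_mult_nth M atLeast0AtMost)
      then show ?thesis using Suc by (simp add: mult.assoc mult.commute)
    qed
  qed
  have "W 0 = (\<Sum>j<N. fps_const (r j) * (fps_X * M) ^ j) + (fps_X * M) ^ N * W N" for N
  proof (induction N)
    case (Suc N)
    have "(fps_X * M) ^ N * W N = fps_const (r N) * (fps_X * M) ^ N + (fps_X * M) ^ Suc N * W (Suc N)"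
      by (subst rec) (simp add: algebra_simps)
    then show ?case using Suc by simp
  qed simp
  \<comment> \<open>After \<open>Suc n\<close> iterations the remainder is divisible by
    \<open>X^(n+1)\<close>, so it does not affect the coefficient of \<open>X^n\<close>.\<close>
  from this[of "Suc n"] have "W 0 = (\<Sum>j\<le>n. fps_const (r j) * (fps_X * M) ^ j) + fps_X ^ Suc n * (M ^ Suc n * W (Suc n))"
    by (simp only: power_mult_distrib mult.assoc lessThan_Suc_atMost)
  then have "W 0 $ n = (\<Sum>j\<le>n. r j * ((fps_X * M) ^ j) $ n)"
    by (simp only: fps_add_nth fps_X_power_mult_nth) (simp add: fps_sum_nth)
  \<comment> \<open>The index \<open>0\<close> drops out because its power is the constant series
    \<open>1\<close> and \<open>n > 0\<close>.\<close>
  also have "\<dots> = (\<Sum>j=1..n. r j * ((fps_X * M) ^ j) $ n)"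
    by (rule sum.mono_neutral_right) (use assms(2) in \<open>auto simp: Suc_le_eq\<close>)
  also have "W 0 $ n = m n"
    using assms by (simp add: W_def shifted_moment_def shifted_ext_def free_cumulants_of_def mult_ext_def)
  finally show ?thesis by (simp add: M_def)
qed

section \<open>Finite free cumulants and moments\<close>

text \<open>With \<open>d = degree p\<close> this operator turns the cumulant series of \<open>p\<close> into the reversed polynomial
  \<open>\<Prod>(1 - r\<^sub>i X)\<close>.\<close>
definition falling_op :: "nat \<Rightarrow> complex fps \<Rightarrow> complex fps" where
  "falling_op d F = Abs_fps (\<lambda>i. falling d i / of_nat d ^ i * F $ i)"

text \<open>Conjugating multiplication by \<open>X\<close> with \<^const>\<open>falling_op\<close> \<open>d\<close> gives \<open>X (1 - X D / d)\<close>; on series of the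
  form \<open>f E\<close>, where \<open>X E' = - d (M - 1) E\<close>, that operator acts on \<open>f\<close> as follows, with \<open>c = 1 / d\<close>.\<close>
definition moment_op :: "complex \<Rightarrow> complex fps \<Rightarrow> complex fps \<Rightarrow> complex fps" where
  "moment_op c M f = fps_X * (M * f - fps_const c * (fps_X * fps_deriv f))"

text \<open>The diagonal entries satisfy \<open>(d)_(k+1) / d^(k+1) = (d)_k / d^k (1 - k/d)\<close>,
  and \<open>X D\<close> multiplies the coefficient of \<open>X^k\<close> by
  \<open>k\<close>.\<close>

lemma falling_op_X_mult:
  assumes "d > 0"
  shows "falling_op d (fps_X * F) =
    fps_X * (falling_op d F - fps_const (1 / of_nat d) * (fps_X * fps_deriv (falling_op d F)))"
proof (rule fps_ext)
  fix n
  show "falling_op d (fps_X * F) $ n =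
    (fps_X * (falling_op d F - fps_const (1 / of_nat d) * (fps_X * fps_deriv (falling_op d F)))) $ n"
  proof (cases n)
    case 0 then show ?thesis by (simp add: falling_op_def)
  next
    case (Suc k)
    have "falling d (Suc k) = falling d k * (of_nat d - of_nat k)"
      by (simp add: falling_def)
    moreover have "(fps_X * fps_deriv (falling_op d F)) $ k = of_nat k * falling_op d F $ k"
      by (cases k) auto
    moreover have "falling d k * (of_nat d - of_nat k) / (of_nat d * of_nat d ^ k) * F $ k =
        falling d k / of_nat d ^ k * F $ k - 1 / of_nat d * (of_nat k * (falling d k / of_nat d ^ k * F $ k))"
      using assms by (simp add: divide_simps) (simp add: algebra_simps)
    ultimately show ?thesis
      by (simp only: Suc fps_X_mult_nth fps_sub_nth fps_mult_left_const_nth falling_op_def fps_nth_Abs_fps power_Suc) simp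
  qed
qed

lemma falling_op_euler: "falling_op d (fps_X * fps_deriv F) = fps_X * fps_deriv (falling_op d F)"
proof (rule fps_ext)
  fix n show "falling_op d (fps_X * fps_deriv F) $ n = (fps_X * fps_deriv (falling_op d F)) $ n"
    by (cases n) (auto simp: falling_op_def)
qed

text \<open>In the product rule the derivative of \<open>E\<close> contributes
  \<open>(M - 1) f E\<close>, which completes \<open>f E\<close> to \<open>M f E\<close>.\<close>

lemma moment_op_twist:
  assumes "d > 0"
    and "fps_X * fps_deriv E = fps_const (- of_nat d) * ((M - 1) * E)"
  shows "fps_X * (f * E - fps_const (1 / of_nat d) * (fps_X * fps_deriv (f * E))) =
    moment_op (1 / of_nat d) M f * E"
proof -
  define c :: "complex fps" where "c = fps_const (1 / of_nat d)"
  have c: "c * fps_const (- of_nat d) = -1"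
    using assms(1) by (simp add: c_def fps_eq_iff)
  have "c * (fps_X * fps_deriv (f * E)) = c * (fps_X * fps_deriv f * E) + f * (c * (fps_X * fps_deriv E))"
    by (simp add: algebra_simps)
  also have "c * (fps_X * fps_deriv E) = (c * fps_const (- of_nat d)) * ((M - 1) * E)"
    by (simp only: assms(2) mult.assoc)
  also have "\<dots> = - ((M - 1) * E)" by (simp add: c)
  finally have "f * E - c * (fps_X * fps_deriv (f * E)) = (M * f - c * (fps_X * fps_deriv f)) * E"
    by (simp add: algebra_simps)
  then show ?thesis unfolding moment_op_def c_def[symmetric] by (simp add: mult.assoc)
qed

lemma falling_op_X_power_mult:
  assumes "d > 0"
    and "fps_X * fps_deriv E = fps_const (- of_nat d) * ((M - 1) * E)"
    and "falling_op d C = E"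
  shows "falling_op d (fps_X ^ j * C) = (moment_op (1 / of_nat d) M ^^ j) 1 * E"
proof (induction j)
  case 0
  show ?case using assms(3) by simp
next
  case (Suc j)
  have "falling_op d (fps_X ^ Suc j * C) = falling_op d (fps_X * (fps_X ^ j * C))"
    by (simp add: mult.assoc)
  also have "\<dots> = moment_op (1 / of_nat d) M ((moment_op (1 / of_nat d) M ^^ j) 1) * E"
    unfolding falling_op_X_mult[OF assms(1)] Suc.IH by (rule moment_op_twist[OF assms(1,2)])
  finally show ?case by simp
qed

section \<open>Power sums of the roots and the reversed polynomial\<close>

lemma euler_prod_mset_one_minus:
  fixes A :: "complex multiset"
  shows "fps_X * fps_deriv (\<Prod>x\<in>#A. 1 - fps_const x * fps_X) =
    - (Abs_fps (\<lambda>n. if n = 0 then 0 else \<Sum>x\<in>#A. x ^ n) * (\<Prod>x\<in>#A. 1 - fps_const x * fps_X))"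
proof (induction A)
  case empty
  show ?case by (simp add: fps_eq_iff)
next
  case (add a A)
  define S where "S = Abs_fps (\<lambda>n. if n = 0 then 0 else \<Sum>x\<in>#A. x ^ n)"
  \<comment> \<open>\<open>G\<close> is the geometric series \<open>a X / (1 - a X)\<close>: up to
    sign, the contribution of one root to the logarithmic derivative.\<close>
  define G where "G = Abs_fps (\<lambda>n. if n = 0 then 0 else a ^ n)"
  define P where "P = (\<Prod>x\<in>#A. 1 - fps_const x * fps_X)"
  have G: "G * (1 - fps_const a * fps_X) = fps_const a * fps_X"
  proof (rule fps_ext)
    fix n
    have "G * (1 - fps_const a * fps_X) = G - fps_const a * (fps_X * G)"
      by (simp add: algebra_simps)
    moreover have "(G - fps_const a * (fps_X * G)) $ n = (fps_const a * fps_X) $ n"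
      by (cases n) (auto simp: G_def fps_X_nth power_Suc split: if_splits)
    ultimately show "(G * (1 - fps_const a * fps_X)) $ n = (fps_const a * fps_X) $ n" by simp
  qed
  have IH: "fps_X * fps_deriv P = - (S * P)" using add.IH by (simp add: P_def S_def)
  have SG: "Abs_fps (\<lambda>n. if n = 0 then 0 else \<Sum>x\<in>#add_mset a A. x ^ n) = G + S"
    by (auto simp: fps_eq_iff G_def S_def)
  have "fps_X * fps_deriv ((1 - fps_const a * fps_X) * P) =
      (1 - fps_const a * fps_X) * (fps_X * fps_deriv P) - (fps_const a * fps_X) * P"
    by (simp add: algebra_simps)
  also have "\<dots> = (1 - fps_const a * fps_X) * - (S * P) - G * (1 - fps_const a * fps_X) * P"
    by (simp only: IH G)
  also have "\<dots> = - ((G + S) * ((1 - fps_const a * fps_X) * P))"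
    by (simp add: algebra_simps)
  finally show ?case using SG by (simp add: P_def)
qed

text \<open>Reversal is multiplicative and sends \<open>X - x\<close> to
  \<open>1 - x X\<close>.\<close>

lemma fps_of_reflect_poly_monic:
  fixes p :: "complex poly"
  assumes "lead_coeff p = 1"
  shows "fps_of_poly (reflect_poly p) = (\<Prod>x\<in>#proots p. 1 - fps_const x * fps_X)"
proof -
  have *: "fps_of_poly (reflect_poly (\<Prod>x\<in>#A. [:-x, 1:])) = (\<Prod>x\<in>#A. 1 - fps_const x * fps_X)"
    for A :: "complex multiset"
  proof (induction A)
    case (add x A)
    have "fps_of_poly (reflect_poly [:-x, 1:]) = 1 - fps_const x * fps_X"
      by (auto simp: fps_eq_iff coeff_reflect_poly coeff_pCons less_Suc_eq split: nat.split)
    then show ?case using add by (simp only: image_mset_add_mset prod_mset.add_mset reflect_poly_mult fps_of_poly_mult)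
  qed simp
  have "p = (\<Prod>x\<in>#proots p. [:-x, 1:])"
    using complex_poly_decompose_multiset[of p] assms by simp
  then show ?thesis using *[of "proots p"] by simp
qed

text \<open>Newton's identities as a differential equation: the power sums are
  \<open>degree p\<close> times the moments.\<close>

lemma euler_reflect_poly:
  fixes p :: "complex poly"
  assumes "lead_coeff p = 1" "degree p > 0"
  shows "fps_X * fps_deriv (fps_of_poly (reflect_poly p)) =
    fps_const (- of_nat (degree p)) * ((moment_fps (poly_moment p) - 1) * fps_of_poly (reflect_poly p))"
proof -
  have "Abs_fps (\<lambda>n. if n = 0 then 0 else \<Sum>x\<in>#proots p. x ^ n) =
      fps_const (of_nat (degree p)) * (moment_fps (poly_moment p) - 1)"
    using assms(2) by (auto simp: fps_eq_iff moment_fps_def poly_moment_def)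
  then show ?thesis
    using euler_prod_mset_one_minus[of "proots p"] fps_of_reflect_poly_monic[OF assms(1)]
    by (simp add: mult.assoc flip: fps_const_neg)
qed

lemma falling_nonzero: "i \<le> d \<Longrightarrow> falling d i \<noteq> 0"
  by (auto simp: falling_def)

text \<open>The signs of \<open>(-d)^i\<close> and \<open>signed_coeff\<close> cancel, and the
  operator removes \<open>d^i / (d)_i\<close>. This leaves the coefficients of \<open>p\<close> in
  reversed order; beyond \<open>degree p\<close> both sides vanish.\<close>

lemma falling_op_cumulant_series:
  assumes "degree p > 0"
  shows "falling_op (degree p) (cumulant_series p) = fps_of_poly (reflect_poly p)"
proof (rule fps_ext)
  fix i
  have "(- of_nat (degree p)) ^ i = (-1) ^ i * (of_nat (degree p) ^ i :: complex)"
    by (rule power_minus)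
  moreover have "(-1) ^ i * (-1) ^ i = (1::complex)" by (simp flip: power_mult_distrib)
  ultimately show "falling_op (degree p) (cumulant_series p) $ i = fps_of_poly (reflect_poly p) $ i"
    using assms falling_nonzero[of i "degree p"]
    by (simp add: falling_op_def cumulant_series_def signed_coeff_def coeff_reflect_poly field_simps)
qed

section \<open>The logarithmic derivative and the exact moment-cumulant identity\<close>

lemma fps_deriv_log:
  assumes "F $ 0 = 1"
  shows "fps_deriv (fps_log F) * F = fps_deriv F"
proof -
  have F: "(F - 1) $ 0 = 0" using assms by simp
  \<comment> \<open>For the chain rule: \<open>fps_ln 1\<close> has derivative
    \<open>1 / (1 + X)\<close>, which becomes \<open>1 / F\<close> under composition with
    \<open>F - 1\<close>.\<close>
  have "(1 + fps_X) oo (F - 1) = F" 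
    using F by (simp add: fps_compose_add_distrib)
  then have "inverse (1 + fps_X) oo (F - 1) = inverse F"
    using fps_inverse_compose[OF F, of "1 + fps_X"] by simp
  then have "fps_deriv (fps_log F) = inverse F * fps_deriv F"
    unfolding fps_log_def fps_compose_deriv[OF F] fps_ln_deriv by simp
  then show ?thesis using inverse_mult_eq_1[of F] assms
    by (simp add: mult.commute mult.left_commute)
qed

text \<open>The identity is exact in every degree \<open>n > 0\<close>; for
  \<open>j > degree p\<close> the number \<open>finite_free_cumulant p j\<close> is merely a
  coefficient of the logarithmic derivative.\<close>

lemma moment_eq_sum_cumulants:
  assumes "lead_coeff p = 1" "degree p > 0" "n > 0"
  shows "poly_moment p n = (\<Sum>j=1..n. finite_free_cumulant p j *
    ((moment_op (1 / of_nat (degree p)) (moment_fps (poly_moment p)) ^^ j) 1) $ n)"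
proof -
  define d where "d = degree p"
  define M where "M = moment_fps (poly_moment p)"
  define C where "C = cumulant_series p"
  define E where "E = fps_of_poly (reflect_poly p)"
  define K where "K = fps_const (- 1 / of_nat d) * fps_deriv (fps_log C)"
  define A where "A = moment_op (1 / of_nat d) M"
  define k where "k = finite_free_cumulant p"
  have d: "d > 0" using assms(2) by (simp add: d_def)
  have E: "fps_X * fps_deriv E = fps_const (- of_nat d) * ((M - 1) * E)"
    using euler_reflect_poly assms by (simp add: E_def M_def d_def)
  have TC: "falling_op d C = E"
    using falling_op_cumulant_series assms by (simp add: d_def C_def E_def)
  have TX: "falling_op d (fps_X ^ j * C) = (A ^^ j) 1 * E" for j
    unfolding A_def by (rule falling_op_X_power_mult[OF d E TC])
  have k: "k j = K $ (j - 1)" for j by (simp add: k_def finite_free_cumulant_def K_def d_def C_def)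
  have C0: "C $ 0 = 1"
    using assms by (simp add: C_def cumulant_series_def signed_coeff_def falling_def)
  have "fps_X * fps_deriv C = fps_const (- of_nat d) * (fps_X * K * C)"
  proof -
    have "fps_const (- of_nat d) * fps_const (- 1 / of_nat d) = (1 :: complex fps)"
      using d by (simp add: fps_eq_iff)
    then have "fps_const (- of_nat d) * K = fps_deriv (fps_log C)"
      unfolding K_def by (metis mult.assoc mult.left_neutral)
    then show ?thesis
      using fps_deriv_log[OF C0] by (metis mult.assoc mult.left_commute)
  qed
  \<comment> \<open>Applying \<open>falling_op d\<close>, which commutes with \<open>X D\<close>,
    turns the left side into \<open>X E'\<close>, which is known from the moments.\<close>
  then have "fps_const (- of_nat d) * ((M - 1) * E) = falling_op d (fps_const (- of_nat d) * (fps_X * K * C))"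
    by (metis falling_op_euler E TC)
  also have "\<dots> = fps_const (- of_nat d) * falling_op d (fps_X * K * C)"
    by (simp add: falling_op_def fps_eq_iff)
  finally have ME: "(M - 1) * E = falling_op d (fps_X * K * C)" using d by simp
  \<comment> \<open>Truncating at \<open>n\<close> suffices modulo \<open>X^(n+1)\<close>. All
    coefficients up to \<open>n\<close> are compared because cancelling \<open>E\<close> mixes in
    the lower ones.\<close>
  define Q where "Q = (\<Sum>j=1..n. fps_const (k j) * (A ^^ j) 1)"
  have "((M - 1 - Q) * E) $ i = 0" if "i \<le> n" for i
  proof -
    \<comment> \<open>Index \<open>0\<close> drops because \<open>X K\<close> has no constant term;
      indices above \<open>i\<close> may be added because \<open>X^j C\<close> starts at
      \<open>X^j\<close>.\<close>
    have "(fps_X * K * C) $ i = (\<Sum>j=0..i. (fps_X * K) $ j * C $ (i - j))"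
      by (rule fps_mult_nth)
    also have "\<dots> = (\<Sum>j=1..i. k j * (fps_X ^ j * C) $ i)"
      by (rule sum.mono_neutral_cong_right) (auto simp: k fps_X_power_mult_nth)
    also have "\<dots> = (\<Sum>j=1..n. k j * (fps_X ^ j * C) $ i)"
      by (rule sum.mono_neutral_left) (use that in \<open>auto simp: fps_X_power_mult_nth\<close>)
    finally have "falling_op d (fps_X * K * C) $ i = (\<Sum>j=1..n. k j * falling_op d (fps_X ^ j * C) $ i)"
      by (simp add: falling_op_def sum_distrib_left sum_divide_distrib mult.left_commute)
    also have "\<dots> = (Q * E) $ i"
      by (simp add: TX Q_def sum_distrib_right fps_sum_nth mult.assoc)
    finally have "((M - 1) * E - Q * E) $ i = 0" by (simp add: ME)
    then show ?thesis by (simp only: left_diff_distrib)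
  qed
  then have "((M - 1 - Q) * E * inverse E) $ n = 0"
    unfolding fps_mult_nth[of "(M - 1 - Q) * E"] by simp
  moreover have "E * inverse E = 1"
    using inverse_mult_eq_1[of E] assms(1) by (simp add: E_def mult.commute)
  ultimately have "(M - 1 - Q) $ n = 0" by (simp add: mult.assoc)
  then show ?thesis
    using assms(3) by (simp add: Q_def M_def moment_fps_def fps_sum_nth k_def A_def d_def)
qed

section \<open>Passage to the limit\<close>

lemma tendsto_moment_op_power:
  assumes M: "\<And>n. ((\<lambda>d. M d $ n) \<longlongrightarrow> M' $ n) F" and c: "(c \<longlongrightarrow> 0) F"
  shows "((\<lambda>d. ((moment_op (c d) (M d) ^^ j) 1) $ n) \<longlongrightarrow> ((fps_X * M') ^ j) $ n) F"
proof (induction j arbitrary: n)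
  case 0
  show ?case by simp
next
  case (Suc j)
  show ?case
  proof (cases n)
    case 0
    then show ?thesis by (simp add: moment_op_def)
  next
    case (Suc l)
    \<comment> \<open>Each coefficient is a finite expression in \<open>b\<close> and coefficients
      of \<open>G\<close> and \<open>f\<close>, so limits pass through; at \<open>b = 0\<close> the
      operator is multiplication by \<open>X G\<close>.\<close>
    have op: "moment_op b G f $ Suc l = (\<Sum>i=0..l. G $ i * f $ (l - i)) - b * (of_nat l * f $ l)"
      for b G f
    proof -
      have "(fps_X * fps_deriv f) $ l = of_nat l * f $ l" by (cases l) auto
      then show ?thesis by (simp add: moment_op_def fps_mult_nth[of G])
    qed
    have "((\<lambda>d. moment_op (c d) (M d) ((moment_op (c d) (M d) ^^ j) 1) $ Suc l) \<longlongrightarrow>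
        (\<Sum>i=0..l. M' $ i * ((fps_X * M') ^ j) $ (l - i)) - 0 * (of_nat l * ((fps_X * M') ^ j) $ l)) F"
      unfolding op by (intro tendsto_intros M c Suc.IH)
    moreover have "((fps_X * M') ^ Suc j) $ Suc l = (\<Sum>i=0..l. M' $ i * ((fps_X * M') ^ j) $ (l - i))"
      by (simp add: mult.assoc fps_mult_nth[of M'])
    ultimately show ?thesis by (simp add: Suc)
  qed
qed

text \<open>By strong induction the lower cumulants converge, so the exact identity can be solved
  for the one of index \<open>n\<close> in the limit.\<close>

lemma tendsto_finite_free_cumulant:
  fixes p :: "nat \<Rightarrow> complex poly"
  assumes r: "free_cumulants_of m r"
    and deg: "\<And>d. d \<ge> 1 \<Longrightarrow> degree (p d) = d"
    and monic: "\<And>d. d \<ge> 1 \<Longrightarrow> lead_coeff (p d) = 1"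
    and lim: "\<And>n. n \<ge> 1 \<Longrightarrow> (\<lambda>d. poly_moment (p d) n) \<longlonglongrightarrow> m n"
    and "n \<ge> 1"
  shows "(\<lambda>d. finite_free_cumulant (p d) n) \<longlonglongrightarrow> r n"
  using \<open>n \<ge> 1\<close>
proof (induction n rule: less_induct)
  case (less n)
  define B where "B j d = ((moment_op (1 / of_nat d) (moment_fps (poly_moment (p d))) ^^ j) 1) $ n" for j d
  define L where "L j = ((fps_X * moment_fps m) ^ j) $ n" for j
  have B: "B j \<longlonglongrightarrow> L j" for j
    unfolding B_def L_def
  proof (rule tendsto_moment_op_power)
    show "(\<lambda>d. moment_fps (poly_moment (p d)) $ i) \<longlonglongrightarrow> moment_fps m $ i" for i
      using lim[of i] by (cases "i = 0") (auto simp: moment_fps_def)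
    show "(\<lambda>d. 1 / of_nat d :: complex) \<longlonglongrightarrow> 0" by (rule lim_1_over_n)
  qed
  \<comment> \<open>\<open>(X M)^n = X^n M^n\<close> and \<open>M\<close> has constant coefficient
    \<open>1\<close>; hence the divisor \<open>B n d\<close> has a nonzero limit.\<close>
  have Ln: "L n = 1"
    by (simp add: L_def power_mult_distrib fps_X_power_mult_nth fps_nth_power_0 moment_fps_def)
  have split: "(\<Sum>j=1..n. f j) = (\<Sum>j=1..<n. f j) + f n" for f :: "nat \<Rightarrow> complex"
    using less.prems by (cases n) (auto simp: atLeastLessThanSuc_atLeastAtMost)
  have "(\<lambda>d. (poly_moment (p d) n - (\<Sum>j=1..<n. finite_free_cumulant (p d) j * B j d)) / B n d) \<longlonglongrightarrow>
      (m n - (\<Sum>j=1..<n. r j * L j)) / L n"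
    by (intro tendsto_intros lim B less) (use less.prems Ln in auto)
  also have "(m n - (\<Sum>j=1..<n. r j * L j)) / L n = r n"
  proof -
    have "m n = (\<Sum>j=1..n. r j * L j)"
      unfolding L_def using moment_eq_sum_free_cumulants[OF r, of n] less.prems by simp
    then show ?thesis unfolding split Ln by simp
  qed
  finally have "(\<lambda>d. (poly_moment (p d) n - (\<Sum>j=1..<n. finite_free_cumulant (p d) j * B j d)) / B n d) \<longlonglongrightarrow> r n" .
  \<comment> \<open>Solving for the cumulant requires \<open>B n d\<close> to be nonzero and
    \<open>d \<ge> 1\<close>; both hold eventually.\<close>
  moreover have "\<forall>\<^sub>F d in sequentially. B n d \<noteq> 0"
    using tendsto_imp_eventually_ne[OF B[of n], of 0] Ln by simp
  then have "\<forall>\<^sub>F d in sequentially.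
      (poly_moment (p d) n - (\<Sum>j=1..<n. finite_free_cumulant (p d) j * B j d)) / B n d = finite_free_cumulant (p d) n"
    using eventually_ge_at_top[of 1]
  proof eventually_elim
    case (elim d)
    have "poly_moment (p d) n = (\<Sum>j=1..n. finite_free_cumulant (p d) j * B j d)"
      using moment_eq_sum_cumulants[of "p d" n] monic[of d] deg[of d] elim less.prems by (simp add: B_def)
    then show ?case using elim unfolding split by simp
  qed
  ultimately show ?case by (rule Lim_transform_eventually)
qed

theorem theorem5p2:
  fixes m r :: "nat \<Rightarrow> complex" and p :: "nat \<Rightarrow> complex poly"
  assumes "free_cumulants_of m r"
    and "\<And>d. d \<ge> 1 \<Longrightarrow> degree (p d) = d"
    and "\<And>d. d \<ge> 1 \<Longrightarrow> lead_coeff (p d) = 1"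
    and "\<And>n. n \<ge> 1 \<Longrightarrow> (\<lambda>d. poly_moment (p d) n) \<longlonglongrightarrow> m n"
  shows "(\<forall>n\<ge>1. (\<lambda>d. finite_free_cumulant (p d) n) \<longlonglongrightarrow> r n) \<and>
    (\<forall>n \<sigma>. partition_on {1..n} \<sigma> \<longrightarrow>
       (\<lambda>d. mult_ext (finite_free_cumulant (p d)) \<sigma>) \<longlonglongrightarrow> mult_ext r \<sigma>)"
proof (intro conjI allI impI)
  show lim: "(\<lambda>d. finite_free_cumulant (p d) n) \<longlonglongrightarrow> r n" if "n \<ge> 1" for n
    using assms that by (rule tendsto_finite_free_cumulant)
  fix n :: nat and \<sigma> assume P: "partition_on {1..n} \<sigma>"
  \<comment> \<open>Blocks are nonempty, so the product involves only cumulants of positive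
    index.\<close>
  have "card V \<ge> 1" if "V \<in> \<sigma>" for V
  proof -
    have "V \<subseteq> {1..n}" "V \<noteq> {}" using P that by (auto simp: partition_on_def)
    then show ?thesis by (simp add: Suc_le_eq card_gt_0_iff finite_subset)
  qed
  then show "(\<lambda>d. mult_ext (finite_free_cumulant (p d)) \<sigma>) \<longlonglongrightarrow> mult_ext r \<sigma>"
    unfolding mult_ext_def by (intro tendsto_prod lim)
qed

end
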